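(* Let $\mathcal C$ be a finite collection of tuples $0<a_1<\cdots<a_{d-1}$ of positive integers (for various $d$), and let $f=f_{\mathcal C}$ be the associated family of rotation symmetric Boolean functions. Then the associated shift $(X_f,\sigma)$ is of finite type.
   Context: Rotation symmetric functions: for each $n\ge1$, $f_n:GF(2)^n\to GF(2)$ is $f_n(x_0,\ldots,x_{n-1})=\sum_{(a_1,\ldots,a_{d-1})\in\mathcal C}\ \sum_{i \bmod n}x_i x_{i+a_1}\cdots x_{i+a_{d-1}}$ (subscripts modulo $n$). Shifts: for a finite alphabet $\mathcal A$, give $\mathcal A^{\mathbb Z}$ the product topology and let $\sigma(\mathbf x)_i=x_{i+1}$. A shift over $\mathcal A$ is a closed subset $X\subseteq\mathcal A^{\mathbb Z}$ preserved by $\sigma$. It is of finite type if there is a finite set $\mathcal S$ of finite words over $\mathcal A$ such that $X$ is the set of all sequences in $\mathcal A^{\mathbb Z}$ containing no element of $\mathcal S$ as a (contiguous) subword. The shift $X_f$: define $P_f:GF(2)^{\mathbb Z}\to GF(2)^{\mathbb Z}$ by $P_f(\mathbf x)_i=\sum_{(a_1,\ldots,a_{d-1})\in\mathcal C}x_i x_{i+a_1}\cdots x_{i+a_{d-1}}$ for $i\in\mathbb Z$. Then $X_f\subseteq GF(2)^{\mathbb Z}\times GF(2)^{\mathbb Z}\cong (GF(2)\times GF(2))^{\mathbb Z}$ is the set of pairs $(\mathbf x,\mathbf y)$ with $P_f(\mathbf x)=\mathbf y-\sigma\mathbf y$, viewed as a shift over the alphabet $GF(2)\times GF(2)$ with the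 (diagonal) shift map $\sigma$. *)

theory Defs
  imports "HOL-Analysis.Analysis" "HOL-Library.Z2"
begin

section \<open>Shifts over a finite alphabet\<close>

definition shift_map :: "(int \<Rightarrow> 'a) \<Rightarrow> int \<Rightarrow> 'a" where
  "shift_map x = (\<lambda>i. x (i + 1))"

definition full_shift_topology :: "'a set \<Rightarrow> (int \<Rightarrow> 'a) topology" where
  "full_shift_topology A = product_topology (\<lambda>_. discrete_topology A) UNIV"

text \<open>
  Since the map is invertible on two-sided sequences, ``preserved'' is read as equality of the
  image with \<open>X\<close>, not merely as inclusion.
\<close>

definition is_shift :: "'a set \<Rightarrow> (int \<Rightarrow> 'a) set \<Rightarrow> bool" where
  "is_shift A X \<longleftrightarrow> finite A \<and> closedin (full_shift_topology A) X \<and> shift_map ` X = X"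

definition is_subword :: "'a list \<Rightarrow> (int \<Rightarrow> 'a) \<Rightarrow> bool" where
  "is_subword w x \<longleftrightarrow> (\<exists>i. \<forall>j < length w. x (i + int j) = w ! j)"

definition is_shift_of_finite_type :: "'a set \<Rightarrow> (int \<Rightarrow> 'a) set \<Rightarrow> bool" where
  "is_shift_of_finite_type A X \<longleftrightarrow> is_shift A X \<and>
     (\<exists>S. finite S \<and> S \<subseteq> lists A \<and>
        X = {x. (\<forall>i. x i \<in> A) \<and> (\<forall>w\<in>S. \<not> is_subword w x)})"

section \<open>Rotation symmetric Boolean functions and their shifts\<close>

text \<open>
  A tuple $(a_1, \ldots, a_{d-1})$ is a list of naturals; the case $d = 1$ of the empty tuple
  (the linear monomial $x_i$) is allowed. Only the values of \<open>x\<close> on \<open>{..<n}\<close> matter for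
  \<open>rotation_symmetric C n x\<close> when $n \ge 1$.
\<close>

definition rotation_symmetric :: "nat list set \<Rightarrow> nat \<Rightarrow> (nat \<Rightarrow> bit) \<Rightarrow> bit" where
  "rotation_symmetric C n x =
     (\<Sum>as\<in>C. \<Sum>i<n. x i * (\<Prod>a\<leftarrow>as. x ((i + a) mod n)))"

definition P_map :: "nat list set \<Rightarrow> (int \<Rightarrow> bit) \<Rightarrow> int \<Rightarrow> bit" where
  "P_map C x = (\<lambda>i. \<Sum>as\<in>C. x i * (\<Prod>a\<leftarrow>as. x (i + int a)))"

text \<open>
  The shift is determined by the collection \<open>C\<close> through \<open>P_map\<close>, of which the functions
  \<open>rotation_symmetric C n\<close> are the traces on \<open>n\<close>-periodic sequences:
\<close>

lemma rotation_symmetric_eq_P_map: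
  "rotation_symmetric C n x = (\<Sum>i<n. P_map C (\<lambda>k. x (nat (k mod int n))) (int i))"
proof -
  have "nat ((int i + int a) mod int n) = (i + a) mod n" for i a
    by (metis nat_int of_nat_add zmod_int)
  moreover have "nat (int i mod int n) = i" if "i < n" for i
    using that by simp
  ultimately show ?thesis
    unfolding rotation_symmetric_def P_map_def
    by (subst sum.swap) (intro sum.cong refl, simp)
qed

definition X_shift :: "nat list set \<Rightarrow> (int \<Rightarrow> bit \<times> bit) set" where
  "X_shift C = {(\<lambda>i. (x i, y i)) | x y. P_map C x = (\<lambda>i. y i - shift_map y i)}"

end

theory Submission
  imports Defs
begin

text \<open>
  The equation $P_f(x) = y - \sigma y$ at position $i$ only involves the coordinates of
  $(x, y)$ in a window $[i, i + L)$ whose length $L$ depends on the finite collection alone.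
  Hence the points of the shift are those avoiding the finitely many words of length $L$ that
  violate the equation, and a set given by forbidden words is automatically closed and
  shift-invariant.
\<close>

lemma is_subword_shift_map: "is_subword w (shift_map x) \<longleftrightarrow> is_subword w x"
proof
  assume "is_subword w (shift_map x)"
  then obtain i where "\<forall>j < length w. x (i + int j + 1) = w ! j"
    by (auto simp: is_subword_def shift_map_def)
  then have "\<forall>j < length w. x ((i + 1) + int j) = w ! j"
    by (simp add: algebra_simps)
  then show "is_subword w x"
    unfolding is_subword_def by blast
next
  assume "is_subword w x"
  then obtain i where "\<forall>j < length w. x (i + int j) = w ! j"
    by (auto simp: is_subword_def)
  then have "\<forall>j < length w. shift_map x ((i - 1) + int j) = w ! j"
    by (simp add: shift_map_def algebra_simps)
  then show "is_subword w (shift_map x)"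
    unfolding is_subword_def by blast
qed

lemma topspace_full_shift: "topspace (full_shift_topology A) = {x. \<forall>i. x i \<in> A}"
  by (auto simp: full_shift_topology_def PiE_def Pi_def)

lemma openin_full_shift_coordinate:
  "openin (full_shift_topology A) {x \<in> topspace (full_shift_topology A). x k = a}"
proof -
  have "continuous_map (full_shift_topology A) (discrete_topology A) (\<lambda>x. x k)"
    unfolding full_shift_topology_def by (rule continuous_map_product_projection) simp
  \<comment> \<open>The letter \<open>a\<close> may lie outside \<open>A\<close>, so the open set
    pulled back along the projection is \<open>A \<inter> {a}\<close>, not
    \<open>{a}\<close>.\<close>
  then have "openin (full_shift_topology A)
      {x \<in> topspace (full_shift_topology A). x k \<in> A \<inter> {a}}"
    by (rule openin_continuous_map_preimage) simp
  moreover have "{x \<in> topspace (full_shift_topology A). x k \<in> A \<inter> {a}} =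
      {x \<in> topspace (full_shift_topology A). x k = a}"
    by (auto simp: topspace_full_shift)
  ultimately show ?thesis
    by simp
qed

text \<open>An occurrence at a fixed position constrains finitely many coordinates, which is an open
  condition; the position then ranges over a union.\<close>

lemma openin_full_shift_subword:
  "openin (full_shift_topology A) {x \<in> topspace (full_shift_topology A). is_subword w x}"
proof -
  let ?T = "full_shift_topology A"
  \<comment> \<open>Intersecting with the space matters for the empty word, where the intersection
    over \<open>j\<close> is all of \<open>UNIV\<close>.\<close>
  have "openin ?T ((\<Inter>j<length w. {x \<in> topspace ?T. x (i + int j) = w ! j}) \<inter> topspace ?T)" for i
    by (rule openin_INT) (auto intro: openin_full_shift_coordinate)
  then have "openin ?T (\<Union>i. (\<Inter>j<length w. {x \<in> topspace ?T. x (i + int j) = w ! j}) \<inter> topspace ?T)"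
    by blast
  moreover have "(\<Union>i. (\<Inter>j<length w. {x \<in> topspace ?T. x (i + int j) = w ! j}) \<inter> topspace ?T) =
      {x \<in> topspace ?T. is_subword w x}"
    by (auto simp: is_subword_def)
  ultimately show ?thesis
    by simp
qed

lemma is_shift_forbidden_words:
  assumes "finite A"
  shows "is_shift A {x. (\<forall>i. x i \<in> A) \<and> (\<forall>w\<in>S. \<not> is_subword w x)}" (is "is_shift A ?X")
  unfolding is_shift_def
proof (intro conjI)
  let ?T = "full_shift_topology A"
  have "openin ?T (\<Union>w\<in>S. {x \<in> topspace ?T. is_subword w x})"
    using openin_full_shift_subword by blast
  then have "closedin ?T (topspace ?T - (\<Union>w\<in>S. {x \<in> topspace ?T. is_subword w x}))"
    by blast
  moreover have "topspace ?T - (\<Union>w\<in>S. {x \<in> topspace ?T. is_subword w x}) = ?X"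
    by (auto simp: topspace_full_shift)
  ultimately show "closedin ?T ?X"
    by simp
  have "x \<in> shift_map ` ?X" if "x \<in> ?X" for x
  proof
    \<comment> \<open>The preimage is the translate in the other direction; it avoids
      \<open>S\<close> because its shift \<open>x\<close> has the same subwords.\<close>
    show x: "x = shift_map (\<lambda>i. x (i - 1))"
      by (simp add: shift_map_def)
    show "(\<lambda>i. x (i - 1)) \<in> ?X"
      using that is_subword_shift_map[of _ "\<lambda>i. x (i - 1)"] x by simp
  qed
  moreover have "shift_map x \<in> ?X" if "x \<in> ?X" for x
    using that by (simp add: is_subword_shift_map) (simp add: shift_map_def)
  ultimately show "shift_map ` ?X = ?X"
    by blast
qed (fact assms)

text \<open>A condition that sees only the coordinates \<open>0, ..., L - 1\<close>, imposed on all
  translates, amounts to forbidding the words of length \<open>L\<close> that violate it; over a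
  finite alphabet these are finitely many.\<close>

lemma is_shift_of_finite_type_local_rule:
  fixes R :: "(int \<Rightarrow> 'a) \<Rightarrow> bool"
  assumes "finite A"
    and local_R: "\<And>x y. (\<And>j. j < L \<Longrightarrow> x (int j) = y (int j)) \<Longrightarrow> R x \<longleftrightarrow> R y"
  shows "is_shift_of_finite_type A {x. (\<forall>i. x i \<in> A) \<and> (\<forall>i. R (\<lambda>k. x (i + k)))}"
    (is "is_shift_of_finite_type A ?X")
proof -
  \<comment> \<open>To test \<open>R\<close> on a word, the word is extended to a two-sided sequence
    by \<open>w ! nat k\<close>. The values outside the window are arbitrary, and
    \<open>local_R\<close> makes them irrelevant.\<close>
  define S where "S = {w \<in> lists A. length w = L \<and> \<not> R (\<lambda>k. w ! nat k)}"
  have "finite {w. set w \<subseteq> A \<and> length w = L}"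
    using assms(1) by (rule finite_lists_length_eq)
  then have "finite S"
    by (rule rev_finite_subset) (auto simp: S_def)
  have "(\<forall>i. R (\<lambda>k. x (i + k))) \<longleftrightarrow> (\<forall>w\<in>S. \<not> is_subword w x)" if A: "\<forall>i. x i \<in> A" for x
  proof (intro iffI allI ballI notI)
    fix w assume R: "\<forall>i. R (\<lambda>k. x (i + k))" and w: "w \<in> S" "is_subword w x"
    then obtain i where i: "\<And>j. j < length w \<Longrightarrow> x (i + int j) = w ! j"
      by (auto simp: is_subword_def)
    have "R (\<lambda>k. x (i + k)) \<longleftrightarrow> R (\<lambda>k. w ! nat k)"
      using w(1) by (intro local_R) (simp add: S_def i)
    with R w(1) show False
      by (simp add: S_def)
  next
    fix i assume S: "\<forall>w\<in>S. \<not> is_subword w x"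
    \<comment> \<open>The window of \<open>x\<close> at \<open>i\<close> has length \<open>L\<close>
      and letters in \<open>A\<close>, so it can stay outside \<open>S\<close> only by satisfying
      \<open>R\<close>.\<close>
    let ?w = "map (\<lambda>j. x (i + int j)) [0..<L]"
    have "is_subword ?w x"
      unfolding is_subword_def by (intro exI[of _ i]) simp
    with S have "?w \<notin> S"
      by blast
    with A have "R (\<lambda>k. ?w ! nat k)"
      by (auto simp: S_def)
    also have "R (\<lambda>k. ?w ! nat k) \<longleftrightarrow> R (\<lambda>k. x (i + k))"
      by (intro local_R) simp
    finally show "R (\<lambda>k. x (i + k))" .
  qed
  then have X: "?X = {x. (\<forall>i. x i \<in> A) \<and> (\<forall>w\<in>S. \<not> is_subword w x)}"
    by blast
  show ?thesis
    unfolding is_shift_of_finite_type_def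
  proof (intro conjI exI)
    show "is_shift A ?X"
      unfolding X using assms(1) by (rule is_shift_forbidden_words)
    show "S \<subseteq> lists A"
      by (auto simp: S_def)
  qed (fact \<open>finite S\<close> X)+
qed

lemma P_map_translate: "P_map C (\<lambda>k. x (i + k)) 0 = P_map C x i"
  by (simp add: P_map_def)

lemma P_map_cong:
  assumes "x i = y i" "\<And>as a. as \<in> C \<Longrightarrow> a \<in> set as \<Longrightarrow> x (i + int a) = y (i + int a)"
  shows "P_map C x i = P_map C y i"
  unfolding P_map_def
  using assms by (intro sum.cong refl arg_cong2[where f = "(*)"] arg_cong[where f = prod_list]) auto

text \<open>The pair \<open>x\<close>, \<open>y\<close> is recovered from \<open>z\<close> by
  projection, so the existential disappears and membership becomes one equation per position, as a
  local rule requires.\<close>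

lemma X_shift_eq:
  "X_shift C = {z. \<forall>i. P_map C (\<lambda>k. fst (z k)) i = snd (z i) - snd (z (i + 1))}"
proof (intro equalityI subsetI)
  fix z assume "z \<in> {z. \<forall>i. P_map C (\<lambda>k. fst (z k)) i = snd (z i) - snd (z (i + 1))}"
  then show "z \<in> X_shift C"
    unfolding X_shift_def shift_map_def
    by (intro CollectI exI[of _ "\<lambda>k. fst (z k)"] exI[of _ "\<lambda>k. snd (z k)"]) auto
qed (auto simp: X_shift_def shift_map_def dest: fun_cong)

theorem theorem2p7:
  fixes C :: "nat list set"
  assumes "finite C"
    and "\<And>as. as \<in> C \<Longrightarrow> sorted_wrt (<) (0 # as)"
  shows "is_shift_of_finite_type (UNIV :: (bit \<times> bit) set) (X_shift C)"
proof -
  \<comment> \<open>The equation at position \<open>0\<close> suffices, since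
    \<open>P_map_translate\<close> carries it to every \<open>i\<close>.\<close>
  define R where
    "R z \<longleftrightarrow> P_map C (\<lambda>k. fst (z k)) 0 = snd (z 0) - snd (z 1)" for z :: "int \<Rightarrow> bit \<times> bit"
  have "finite (\<Union>as\<in>C. set as)"
    using assms(1) by simp
  then obtain N where N: "\<And>as a. as \<in> C \<Longrightarrow> a \<in> set as \<Longrightarrow> a < N"
    by (auto simp: finite_nat_set_iff_bounded)
  \<comment> \<open>The window must contain all offsets below \<open>N\<close> and also the
    positions \<open>0\<close> and \<open>1\<close> read by \<open>y - \<sigma> y\<close>;
    \<open>N + 2\<close> covers both even when \<open>N = 0\<close>.\<close>
  have local_R: "R x \<longleftrightarrow> R y" if *: "\<And>j. j < N + 2 \<Longrightarrow> x (int j) = y (int j)" for x y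
  proof -
    have 01: "x 0 = y 0" "x 1 = y 1"
      using *[of 0] *[of 1] by simp_all
    moreover have "P_map C (\<lambda>k. fst (x k)) 0 = P_map C (\<lambda>k. fst (y k)) 0"
      by (intro P_map_cong) (auto simp: 01 dest!: N intro!: arg_cong[where f = fst] *)
    ultimately show ?thesis
      by (simp add: R_def)
  qed
  have "finite (UNIV :: (bit \<times> bit) set)"
    by (rule finite_subset[of _ "{0, 1} \<times> {0, 1}"]) auto
  then have "is_shift_of_finite_type UNIV
      {z. (\<forall>i. z i \<in> UNIV) \<and> (\<forall>i. R (\<lambda>k. z (i + k)))}"
    using local_R by (rule is_shift_of_finite_type_local_rule)
  moreover have "R (\<lambda>k. z (i + k)) \<longleftrightarrow>
      P_map C (\<lambda>k. fst (z k)) i = snd (z i) - snd (z (i + 1))" for z i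
    using P_map_translate[of C "\<lambda>k. fst (z k)" i] by (simp add: R_def)
  ultimately show ?thesis
    by (simp add: X_shift_eq)
qed

end
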